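(* Let $\sigma(x)$ be a particular solution of the inhomogeneous linear DODS $$\ddot y=a_1(x)\dot y+a_2(x)\dot y_-+a_3(x)y+a_4(x)y_-+b(x),\qquad x_-=g(x).$$ Then this DODS admits an infinite-dimensional Lie point symmetry algebra represented by the vector fields $$X(\rho)=\rho(x)\frac{\partial}{\partial y},\qquad Y(\sigma)=(y-\sigma(x))\frac{\partial}{\partial y},$$ where $\rho(x)$ is the general solution of the corresponding homogeneous linear DODS $$\ddot y=a_1(x)\dot y+a_2(x)\dot y_-+a_3(x)y+a_4(x)y_-,\qquad x_-=g(x).$$
   Context: DODS = delay ordinary differential system. Notation: $y_-=y(x_-)$, $\dot y_-=\dot y(x_-)$. Standing assumptions: $a_i$, $b$ and $g$ are real functions smooth on some interval $x\in I$, $a_2^2+a_4^2\not\equiv0$, $g(x)<x$, $g\not\equiv\mathrm{const}$. Everything is local. "General solution" means that $\rho$ ranges over all solutions. Symmetry: a vector field $X=\xi(x,y)\partial_x+\eta(x,y)\partial_y$ is prolonged to $$\mathbf{pr}X=\xi\partial_x+\eta\partial_y+\xi^-\partial_{x_-}+\eta^-\partial_{y_-}+\zeta^1\partial_{\dot y}+\zeta^{1-}\partial_{\dot y_-}+\zeta^2\partial_{\ddot y},$$ with $\xi^-=\xi(x_-,y_-)$, $\eta^-=\eta(x_-,y_-)$, $\zeta^1=D(\eta)-\dot yD(\xi)$, $\zeta^{1-}=D_-(\eta^-)-\dot y_-D_-(\xi^-)$, $\zeta^2=D(\zeta^1)-\ddot yD(\xi)$, where $D$ and $D_-$ are the total derivative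 operators at $x$ and $x_-$. A system $\ddot y=f$, $x_-=g$ admits $X$ as a Lie point symmetry if $\mathbf{pr}X[\ddot y-f]=0$ and $\mathbf{pr}X[x_--g]=0$ whenever $\ddot y=f$ and $x_-=g$. *)

theory Defs
  imports "HOL-Analysis.Analysis" "HOL-Library.Function_Algebras"
begin

definition open_interval :: "real set \<Rightarrow> bool" where
  "open_interval J \<longleftrightarrow> open J \<and> is_interval J \<and> J \<noteq> {}"

text \<open>Infinite differentiability; only used on open sets.\<close>

definition smooth_on :: "real set \<Rightarrow> (real \<Rightarrow> real) \<Rightarrow> bool" where
  "smooth_on J h \<longleftrightarrow> (\<forall>n. (deriv ^^ n) h differentiable_on J)"


section \<open>Delay ordinary differential systems\<close>

text \<open>
  The right-hand side of y'' = f(x, y, y_-, y', y'_-), x_- = g(x), takes its arguments in this order.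
  A solution on J is a function satisfying the equation for every x in J. Since the equation also
  involves y and y' at the delayed points, it has to be differentiable on g(J) as well; g(J) may
  lie outside J.
\<close>

type_synonym rhs = "real \<Rightarrow> real \<Rightarrow> real \<Rightarrow> real \<Rightarrow> real \<Rightarrow> real"

definition dods_solution :: "rhs \<Rightarrow> (real \<Rightarrow> real) \<Rightarrow> real set \<Rightarrow> (real \<Rightarrow> real) \<Rightarrow> bool" where
  "dods_solution f g J y \<longleftrightarrow>
     (\<forall>x \<in> J \<union> g ` J. y differentiable (at x)) \<and>
     (\<forall>x \<in> J. deriv y differentiable (at x)) \<and>
     (\<forall>x \<in> J. deriv (deriv y) x = f x (y x) (y (g x)) (deriv y x) (deriv y (g x)))"

definition linear_rhs ::
  "(real \<Rightarrow> real) \<Rightarrow> (real \<Rightarrow> real) \<Rightarrow> (real \<Rightarrow> real) \<Rightarrow> (real \<Rightarrow> real) \<Rightarrow> (real \<Rightarrow> real) \<Rightarrow> rhs" where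
  "linear_rhs a1 a2 a3 a4 b = (\<lambda>x y ym y1 y1m. a1 x * y1 + a2 x * y1m + a3 x * y + a4 x * ym + b x)"


section \<open>Vector fields in the (x, y)-plane\<close>

text \<open>The field \<xi> d/dx + \<eta> d/dy is the function (x, y) \<mapsto> (\<xi>, \<eta>).\<close>

type_synonym vector_field = "real \<times> real \<Rightarrow> real \<times> real"

definition vf_scale :: "real \<Rightarrow> vector_field \<Rightarrow> vector_field" where
  "vf_scale c V = (\<lambda>p. c *\<^sub>R V p)"

interpretation vf: vector_space vf_scale
  by unfold_locales (auto simp: vf_scale_def fun_eq_iff scaleR_add_right scaleR_add_left)

definition lie_bracket :: "vector_field \<Rightarrow> vector_field \<Rightarrow> vector_field" where
  "lie_bracket V W = (\<lambda>p. frechet_derivative W (at p) (V p) - frechet_derivative V (at p) (W p))"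

text \<open>
  Vector fields are total functions, but only their values on a given domain D matter: two fields
  that agree on D are the same field on D. Hence the bracket is required to lie in L only up to
  agreement on D, and the dimension is that of the space of restrictions to D.
\<close>

definition lie_algebra_on :: "(real \<times> real) set \<Rightarrow> vector_field set \<Rightarrow> bool" where
  "lie_algebra_on D L \<longleftrightarrow>
     (\<forall>V \<in> L. \<forall>p \<in> D. V differentiable (at p)) \<and>
     vf.subspace L \<and>
     (\<forall>V \<in> L. \<forall>W \<in> L. \<exists>Z \<in> L. \<forall>p \<in> D. Z p = lie_bracket V W p)"

definition restrict_vf :: "(real \<times> real) set \<Rightarrow> vector_field \<Rightarrow> vector_field" where
  "restrict_vf D V = (\<lambda>p. if p \<in> D then V p else 0)"

definition infinite_dimensional_on :: "(real \<times> real) set \<Rightarrow> vector_field set \<Rightarrow> bool" where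
  "infinite_dimensional_on D L \<longleftrightarrow> \<not> (\<exists>B. finite B \<and> restrict_vf D ` L \<subseteq> vf.span B)"


section \<open>Prolongation and Lie point symmetries\<close>

text \<open>
  Total derivatives of functions of (x, y) and of (x, y, y'): d/dx + y' d/dy + y'' d/dy' is the
  derivative in the direction (1, y', y''). The operator at the delayed point is the same one,
  evaluated at (x_-, y_-, y'_-).
\<close>

definition total_deriv0 :: "(real \<times> real \<Rightarrow> real) \<Rightarrow> real \<times> real \<times> real \<Rightarrow> real" where
  "total_deriv0 h = (\<lambda>(x, y, y1). frechet_derivative h (at (x, y)) (1, y1))"

definition total_deriv1 ::
  "(real \<times> real \<times> real \<Rightarrow> real) \<Rightarrow> real \<times> real \<times> real \<times> real \<Rightarrow> real" where
  "total_deriv1 h = (\<lambda>(x, y, y1, y2). frechet_derivative h (at (x, y, y1)) (1, y1, y2))"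

definition zeta1 :: "vector_field \<Rightarrow> real \<times> real \<times> real \<Rightarrow> real" where
  "zeta1 V = (\<lambda>(x, y, y1).
     total_deriv0 (snd \<circ> V) (x, y, y1) - y1 * total_deriv0 (fst \<circ> V) (x, y, y1))"

definition zeta2 :: "vector_field \<Rightarrow> real \<times> real \<times> real \<times> real \<Rightarrow> real" where
  "zeta2 V = (\<lambda>(x, y, y1, y2).
     total_deriv1 (zeta1 V) (x, y, y1, y2) - y2 * total_deriv0 (fst \<circ> V) (x, y, y1))"

text \<open>Jet coordinates: (x, y, x_-, y_-, y', y'_-, y'').\<close>

type_synonym jet = "real \<times> real \<times> real \<times> real \<times> real \<times> real \<times> real"

definition prolong :: "vector_field \<Rightarrow> jet \<Rightarrow> jet" where
  "prolong V = (\<lambda>(x, y, xm, ym, y1, y1m, y2).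
     (fst (V (x, y)), snd (V (x, y)), fst (V (xm, ym)), snd (V (xm, ym)),
      zeta1 V (x, y, y1), zeta1 V (xm, ym, y1m), zeta2 V (x, y, y1, y2)))"

definition pr_annihilates :: "vector_field \<Rightarrow> (jet \<Rightarrow> real) \<Rightarrow> jet \<Rightarrow> bool" where
  "pr_annihilates V F p \<longleftrightarrow> (\<exists>F'. (F has_derivative F') (at p) \<and> F' (prolong V p) = 0)"

text \<open>
  The first two conjuncts ensure that all derivatives occurring in the prolongation exist.
\<close>

definition admits_symmetry :: "rhs \<Rightarrow> (real \<Rightarrow> real) \<Rightarrow> real set \<Rightarrow> vector_field \<Rightarrow> bool" where
  "admits_symmetry f g J V \<longleftrightarrow>
     (\<forall>x \<in> J \<union> g ` J. \<forall>y. V differentiable (at (x, y))) \<and>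
     (\<forall>x \<in> J. \<forall>y y1. zeta1 V differentiable (at (x, y, y1))) \<and>
     (\<forall>x xm y ym y1 y1m y2. x \<in> J \<longrightarrow> y2 = f x y ym y1 y1m \<longrightarrow> xm = g x \<longrightarrow>
        pr_annihilates V (\<lambda>(x, y, xm, ym, y1, y1m, y2). y2 - f x y ym y1 y1m)
          (x, y, xm, ym, y1, y1m, y2) \<and>
        pr_annihilates V (\<lambda>(x, y, xm, ym, y1, y1m, y2). xm - g x)
          (x, y, xm, ym, y1, y1m, y2))"

definition X_field :: "(real \<Rightarrow> real) \<Rightarrow> vector_field" where
  "X_field \<rho> = (\<lambda>(x, y). (0, \<rho> x))"

definition Y_field :: "(real \<Rightarrow> real) \<Rightarrow> vector_field" where
  "Y_field \<sigma> = (\<lambda>(x, y). (0, y - \<sigma> x))"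

text \<open>The points over which the prolonged fields are evaluated for x in J.\<close>

definition base_domain :: "(real \<Rightarrow> real) \<Rightarrow> real set \<Rightarrow> (real \<times> real) set" where
  "base_domain g J = (J \<union> g ` J) \<times> UNIV"

definition linear_symmetries ::
  "(real \<Rightarrow> real) \<Rightarrow> (real \<Rightarrow> real) \<Rightarrow> (real \<Rightarrow> real) \<Rightarrow> (real \<Rightarrow> real) \<Rightarrow>
   (real \<Rightarrow> real) \<Rightarrow> (real \<Rightarrow> real) \<Rightarrow> real set \<Rightarrow> vector_field set" where
  "linear_symmetries a1 a2 a3 a4 g \<sigma> J =
     vf.span ({X_field \<rho> | \<rho>. dods_solution (linear_rhs a1 a2 a3 a4 (\<lambda>_. 0)) g J \<rho>} \<union> {Y_field \<sigma>})"

end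

theory Submission
  imports Defs
begin

text \<open>
  Every field in the span has the form (c y + h(x)) d/dy, where h solves the linear system with
  inhomogeneity -c b. For such a field the prolongation acts on the equation through c times the
  equation itself plus the equation for h, so it vanishes on solutions; the bracket of two such
  fields has c = 0 and is therefore some X(\<rho>).

  For the dimension, the delay is exploited as in the method of steps. Near x0 the values g(x)
  stay to the left of a short interval around x0, so the history of a homogeneous solution can be
  prescribed freely there; solving an ordinary linear equation extends it over the interval.
  Taking the history to be x^n gives solutions that are linearly independent, because a
  nonconstant continuous g has infinite image on an interval and a nonzero polynomial has only
  finitely many roots.
\<close>

section \<open>Existence for ordinary differential equations on a short interval\<close>

text \<open>The Picard operator is Lipschitz with constant \<open>L * (b - a)\<close> in the sup
  norm, so on a short interval it is a contraction and Banach's theorem gives a fixed point. The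
  Lipschitz bound is global in \<open>z\<close>, so iterates cannot leave its range of
  validity.\<close>

lemma picard_lindelof_short_interval:
  fixes G :: "real \<Rightarrow> 'a::banach \<Rightarrow> 'a"
  assumes "a \<le> b" "0 \<le> L" "L * (b - a) < 1"
    and cont: "continuous_on ({a..b} \<times> UNIV) (\<lambda>(t, z). G t z)"
    and lip: "\<And>t z w. t \<in> {a..b} \<Longrightarrow> norm (G t z - G t w) \<le> L * norm (z - w)"
  obtains z where "z a = z0"
    and "\<And>t. t \<in> {a..b} \<Longrightarrow> (z has_vector_derivative G t (z t)) (at t within {a..b})"
proof -
  define P where "P z t = z0 + integral {a..t} (\<lambda>s. G s (apply_bcontfun z s))" for z t
  have contG: "continuous_on {a..b} (\<lambda>s. G s (apply_bcontfun z s))" for z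
  proof -
    have "continuous_on {a..b} (\<lambda>s. (s, apply_bcontfun z s))"
      by (intro continuous_intros continuous_on_apply_bcontfun)
    from continuous_on_compose2[OF cont this] show ?thesis by auto
  qed
  have deriv: "(P z has_vector_derivative G t (apply_bcontfun z t)) (at t within {a..b})"
    if "t \<in> {a..b}" for z t
    unfolding P_def
    by (auto intro!: derivative_eq_intros integral_has_vector_derivative contG that)
  \<comment> \<open>The complete space used consists of bounded continuous functions on the whole
    line. Precomposing with \<open>clamp\<close> extends \<open>P z\<close> from
    \<open>{a..b}\<close> by its endpoint values and makes it an element of that space.\<close>
  have "\<exists>w. \<forall>t. apply_bcontfun w t = P z (clamp a b t)" for z
  proof -
    have "continuous_on (cbox a b) (P z)"
      unfolding cbox_interval continuous_on_eq_continuous_within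
      using deriv has_vector_derivative_continuous by blast
    then show ?thesis
      by (rule continuous_on_cbox_bcontfunE) blast
  qed
  then obtain T where T: "apply_bcontfun (T z) t = P z (clamp a b t)" for z t
    by metis
  have clamp: "clamp a b t \<in> {a..b}" for t
    using clamp_in_interval[of a b t] \<open>a \<le> b\<close> by simp
  have "dist (T z) (T w) \<le> (L * (b - a)) * dist z w" for z w
  proof (rule dist_bound)
    fix t
    define c where "c = clamp a b t"
    have c: "a \<le> c" "c \<le> b" using clamp[of t] by (auto simp: c_def)
    have sub: "continuous_on {a..c} (\<lambda>s. G s (apply_bcontfun z s))" for z
      using contG c by (rule_tac continuous_on_subset) auto
    have "norm (integral {a..c} (\<lambda>s. G s (apply_bcontfun z s) - G s (apply_bcontfun w s)))
        \<le> (L * dist z w) * (c - a)"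
    proof (rule integral_bound)
      fix s assume "s \<in> {a..c}"
      then have "norm (G s (apply_bcontfun z s) - G s (apply_bcontfun w s))
          \<le> L * dist (apply_bcontfun z s) (apply_bcontfun w s)"
        using lip c by (auto simp: dist_norm)
      also have "\<dots> \<le> L * dist z w"
        using \<open>0 \<le> L\<close> by (intro mult_left_mono dist_bounded)
      finally show "norm (G s (apply_bcontfun z s) - G s (apply_bcontfun w s)) \<le> L * dist z w" .
    qed (use c sub in \<open>auto intro!: continuous_intros\<close>)
    also have "\<dots> \<le> (L * dist z w) * (b - a)"
      using c \<open>0 \<le> L\<close> by (intro mult_left_mono) auto
    finally show "dist (apply_bcontfun (T z) t) (apply_bcontfun (T w) t) \<le> (L * (b - a)) * dist z w"
      by (simp add: T P_def dist_norm c_def[symmetric] integral_diff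
          integrable_continuous_interval sub mult_ac)
  qed
  moreover have "0 \<le> L * (b - a)" using assms by simp
  ultimately obtain z where z: "T z = z"
    using banach_fix_type[of "L * (b - a)" T] \<open>L * (b - a) < 1\<close> by blast
  have eq: "apply_bcontfun z t = P z t" if "t \<in> {a..b}" for t
    using T[of z t] that by (simp add: z)
  show ?thesis
  proof
    show "apply_bcontfun z a = z0"
      using eq[of a] \<open>a \<le> b\<close> by (simp add: P_def)
    show "(apply_bcontfun z has_vector_derivative G t (apply_bcontfun z t)) (at t within {a..b})"
      if "t \<in> {a..b}" for t
      by (rule has_vector_derivative_transform[OF that eq deriv[OF that]])
  qed
qed

text \<open>The first-order system for the pair (y, y') has Lipschitz constant
  \<open>1 + 2 * A\<close>: one unit from the component y' and \<open>A\<close> from each of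
  \<open>p\<close> and \<open>q\<close>. Initial values are left open, since any solution will serve
  as a continuation of a history.\<close>

lemma linear_second_order_ode_short_interval:
  fixes p q f :: "real \<Rightarrow> real"
  assumes "a \<le> b" "(1 + 2 * A) * (b - a) < 1"
    and cont: "continuous_on {a..b} p" "continuous_on {a..b} q" "continuous_on {a..b} f"
    and bound: "\<And>t. t \<in> {a..b} \<Longrightarrow> \<bar>p t\<bar> \<le> A" "\<And>t. t \<in> {a..b} \<Longrightarrow> \<bar>q t\<bar> \<le> A"
  obtains y y1 where
    "\<And>t. t \<in> {a<..<b} \<Longrightarrow> (y has_real_derivative y1 t) (at t)"
    "\<And>t. t \<in> {a<..<b} \<Longrightarrow> (y1 has_real_derivative p t * y1 t + q t * y t + f t) (at t)"
proof -
  have "0 \<le> A" using bound(1)[of a] \<open>a \<le> b\<close> by force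
  define G where "G t z = (snd z, p t * snd z + q t * fst z + f t)" for t and z :: "real \<times> real"
  have fst': "continuous_on ({a..b} \<times> UNIV) (\<lambda>x. h (fst x))" if "continuous_on {a..b} h"
    for h :: "real \<Rightarrow> real"
    by (rule continuous_on_compose2[OF that]) (auto intro: continuous_intros)
  have "continuous_on ({a..b} \<times> UNIV) (\<lambda>(t, z). G t z)"
    unfolding G_def case_prod_beta by (intro continuous_intros fst' cont)
  moreover have "norm (G t z - G t w) \<le> (1 + 2 * A) * norm (z - w)" if t: "t \<in> {a..b}" for t z w
  proof -
    define d where "d = z - w"
    have "norm (G t z - G t w) = norm (snd d, p t * snd d + q t * fst d)"
      by (simp add: G_def d_def algebra_simps)
    also have "\<dots> \<le> \<bar>snd d\<bar> + \<bar>p t * snd d + q t * fst d\<bar>"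
      using norm_Pair_le[of "snd d" "p t * snd d + q t * fst d"] by simp
    also have "\<dots> \<le> norm d + (A * norm d + A * norm d)"
    proof -
      have "\<bar>snd d\<bar> \<le> norm d" "\<bar>fst d\<bar> \<le> norm d"
        using norm_snd_le[of "snd d" "fst d"] norm_fst_le[of "fst d" "snd d"] by simp_all
      then have "\<bar>p t\<bar> * \<bar>snd d\<bar> \<le> A * norm d" "\<bar>q t\<bar> * \<bar>fst d\<bar> \<le> A * norm d"
        using bound[OF t] \<open>0 \<le> A\<close> by (auto intro!: mult_mono)
      then show ?thesis
        using \<open>\<bar>snd d\<bar> \<le> norm d\<close> abs_triangle_ineq[of "p t * snd d" "q t * fst d"]
        by (simp add: abs_mult)
    qed
    finally show ?thesis by (simp add: d_def algebra_simps)
  qed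
  moreover have "0 \<le> 1 + 2 * A" using \<open>0 \<le> A\<close> by simp
  ultimately obtain z where
    z: "\<And>t. t \<in> {a..b} \<Longrightarrow> (z has_vector_derivative G t (z t)) (at t within {a..b})"
    using picard_lindelof_short_interval[of a b "1 + 2 * A" G] assms(1,2) by metis
  have z': "(z has_vector_derivative G t (z t)) (at t)" if "t \<in> {a<..<b}" for t
    using z[of t] that by (simp add: at_within_Icc_at)
  show ?thesis
  proof
    fix t assume t: "t \<in> {a<..<b}"
    have "((\<lambda>t. fst (z t)) has_vector_derivative fst (G t (z t))) (at t)"
      by (rule bounded_linear.has_vector_derivative[OF bounded_linear_fst z'[OF t]])
    then show "((\<lambda>t. fst (z t)) has_real_derivative snd (z t)) (at t)"
      by (simp add: has_real_derivative_iff_has_vector_derivative G_def)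
    have "((\<lambda>t. snd (z t)) has_vector_derivative snd (G t (z t))) (at t)"
      by (rule bounded_linear.has_vector_derivative[OF bounded_linear_snd z'[OF t]])
    then show "((\<lambda>t. snd (z t)) has_real_derivative p t * snd (z t) + q t * fst (z t) + f t) (at t)"
      by (simp add: has_real_derivative_iff_has_vector_derivative G_def)
  qed
qed

section \<open>Smooth coefficients and solutions of delay systems\<close>

lemma smooth_on_DERIV:
  assumes "smooth_on I h" "open I" "x \<in> I"
  shows "(h has_real_derivative deriv h x) (at x)"
proof -
  have "h differentiable_on I"
    using assms(1)[unfolded smooth_on_def, rule_format, of 0] by simp
  then have "h differentiable (at x)"
    using assms(2,3) by (simp add: differentiable_on_eq_differentiable_at)
  then show ?thesis by (simp add: DERIV_deriv_iff_real_differentiable)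
qed

lemma smooth_on_subset: "smooth_on I h \<Longrightarrow> K \<subseteq> I \<Longrightarrow> smooth_on K h"
  unfolding smooth_on_def by (blast intro: differentiable_on_subset)

lemma smooth_on_imp_continuous_on:
  assumes "smooth_on I h"
  shows "continuous_on I h"
  using assms[unfolded smooth_on_def, rule_format, of 0]
  by (simp add: differentiable_imp_continuous_on)

text \<open>Allows the derivative to be given by a formula \<open>y1\<close> instead of
  \<open>deriv y\<close>. Both agree on the open set \<open>K\<close>, hence near each of its
  points, which carries the second derivative over; at delayed points only the first derivative
  matters.\<close>

lemma dods_solutionI:
  assumes "open K"
    and y: "\<And>x. x \<in> K \<union> g ` K \<Longrightarrow> (y has_real_derivative y1 x) (at x)"
    and y1: "\<And>x. x \<in> K \<Longrightarrow> (y1 has_real_derivative f x (y x) (y (g x)) (y1 x) (y1 (g x))) (at x)"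
  shows "dods_solution f g K y"
proof -
  have eq: "deriv y x = y1 x" if "x \<in> K \<union> g ` K" for x
    using y[OF that] by (rule DERIV_imp_deriv)
  have "(deriv y has_real_derivative f x (y x) (y (g x)) (y1 x) (y1 (g x))) (at x)" if "x \<in> K" for x
    by (rule has_field_derivative_transform_within_open[OF y1[OF that] \<open>open K\<close> that]) (simp add: eq)
  then show ?thesis
    unfolding dods_solution_def
    by (metis DERIV_imp_deriv UnI1 UnI2 eq imageI real_differentiable_def y)
qed

lemma dods_solutionD:
  assumes "dods_solution f g K y"
  shows "x \<in> K \<union> g ` K \<Longrightarrow> (y has_real_derivative deriv y x) (at x)"
    and "x \<in> K \<Longrightarrow>
      (deriv y has_real_derivative f x (y x) (y (g x)) (deriv y x) (deriv y (g x))) (at x)"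
  using assms unfolding dods_solution_def
  by (auto simp: DERIV_deriv_iff_real_differentiable[symmetric])

lemma dods_solution_mono:
  "dods_solution f g J y \<Longrightarrow> K \<subseteq> J \<Longrightarrow> dods_solution f g K y"
  unfolding dods_solution_def by blast

text \<open>Superposition, with the inhomogeneities combined by the same coefficients. Keeping track
  of them lets one statement cover homogeneous solutions, multiples of \<sigma>, and the
  cancellation in the bracket.\<close>

lemma dods_solution_linear_combination:
  assumes "open K" "dods_solution (linear_rhs a1 a2 a3 a4 b) g K u"
    and "dods_solution (linear_rhs a1 a2 a3 a4 b') g K v"
  shows "dods_solution (linear_rhs a1 a2 a3 a4 (\<lambda>x. r * b x + s * b' x)) g K (\<lambda>x. r * u x + s * v x)"
proof (rule dods_solutionI[OF \<open>open K\<close>])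
  show "((\<lambda>x. r * u x + s * v x) has_real_derivative r * deriv u x + s * deriv v x) (at x)"
    if "x \<in> K \<union> g ` K" for x
    using dods_solutionD(1)[OF assms(2) that] dods_solutionD(1)[OF assms(3) that]
    by (auto intro!: derivative_eq_intros)
  show "((\<lambda>x. r * deriv u x + s * deriv v x) has_real_derivative
      linear_rhs a1 a2 a3 a4 (\<lambda>x. r * b x + s * b' x) x (r * u x + s * v x)
        (r * u (g x) + s * v (g x)) (r * deriv u x + s * deriv v x)
        (r * deriv u (g x) + s * deriv v (g x))) (at x)"
    if "x \<in> K" for x
    by (rule derivative_eq_intros dods_solutionD(2)[OF assms(2) that]
        dods_solutionD(2)[OF assms(3) that] refl)+
      (simp add: linear_rhs_def algebra_simps)
qed

section \<open>Vertical fields and their prolongation\<close>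

text \<open>A common shape for both kinds of generators that is closed under linear combinations, so
  that the symmetry condition can be checked for a whole span by one computation.\<close>

definition vertical_field :: "real \<Rightarrow> (real \<Rightarrow> real) \<Rightarrow> vector_field" where
  "vertical_field c h = (\<lambda>p. (0, c * snd p + h (fst p)))"

lemma X_field_eq_vertical_field: "X_field h = vertical_field 0 h"
  and Y_field_eq_vertical_field: "Y_field h = vertical_field 1 (\<lambda>x. - h x)"
  by (auto simp: X_field_def Y_field_def vertical_field_def)

text \<open>The condition that \<open>h\<close> solves the system with inhomogeneity
  \<open>- c * b\<close> is linear in the pair (c, h), so it passes from generators to the span. For
  \<open>X_field\<close> it holds with c = 0, for \<open>Y_field\<close> with c = 1 and h =
  -\<sigma>.\<close>

lemma linear_symmetries_imp_vertical:
  assumes "open K" "dods_solution (linear_rhs a1 a2 a3 a4 b) g K \<sigma>"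
    and "V \<in> linear_symmetries a1 a2 a3 a4 g \<sigma> K"
  obtains c h where "V = vertical_field c h"
    and "dods_solution (linear_rhs a1 a2 a3 a4 (\<lambda>x. - c * b x)) g K h"
proof -
  let ?S = "\<lambda>c h. dods_solution (linear_rhs a1 a2 a3 a4 (\<lambda>x. - c * b x)) g K h"
  let ?P = "\<lambda>V. \<exists>c h. V = vertical_field c h \<and> ?S c h"
  have comb: "?S (r * c + s * d) (\<lambda>x. r * h x + s * k x)" if "?S c h" "?S d k" for r s c d h k
    using dods_solution_linear_combination[OF \<open>open K\<close> that, of r s] by (simp add: algebra_simps)
  have Y: "?S 1 (\<lambda>x. - \<sigma> x)"
    using dods_solution_linear_combination[OF \<open>open K\<close> assms(2,2), of "-1" 0] by simp
  have zero: "?S 0 (\<lambda>x. 0)"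
    using dods_solution_linear_combination[OF \<open>open K\<close> assms(2,2), of 0 0] by simp
  have "?P V" using assms(3) unfolding linear_symmetries_def
  proof (rule vf.span_induct_alt)
    show "?P 0"
      using zero by (intro exI[of _ 0] exI[of _ "\<lambda>x. 0"])
        (auto simp: vertical_field_def fun_eq_iff zero_prod_def)
    fix r U W
    assume U: "U \<in> {X_field \<rho> |\<rho>. dods_solution (linear_rhs a1 a2 a3 a4 (\<lambda>_. 0)) g K \<rho>} \<union> {Y_field \<sigma>}"
      and "?P W"
    then obtain d k where W: "W = vertical_field d k" "?S d k" by auto
    obtain c h where "U = vertical_field c h" "?S c h"
      using U Y by (auto simp: X_field_eq_vertical_field Y_field_eq_vertical_field)
    then show "?P (vf_scale r U + W)"
      using W comb[of c h d k r 1]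
      by (intro exI[of _ "r * c + d"] exI[of _ "\<lambda>x. r * h x + k x"])
        (auto simp: vertical_field_def vf_scale_def fun_eq_iff algebra_simps)
  qed
  then show ?thesis using that by blast
qed

lemma has_derivative_vertical_field:
  assumes "(h has_real_derivative h') (at (fst p))"
  shows "(vertical_field c h has_derivative (\<lambda>v. (0, c * snd v + h' * fst v))) (at p)"
proof -
  have "((\<lambda>p. h (fst p)) has_derivative (\<lambda>v. h' * fst v)) (at p)"
    using has_derivative_compose[OF has_derivative_fst[OF has_derivative_ident]
        assms[unfolded has_field_derivative_def]] .
  then show ?thesis
    unfolding vertical_field_def by (auto intro!: derivative_eq_intros)
qed

lemma zeta1_vertical_field:
  assumes "(h has_real_derivative h') (at x)"
  shows "zeta1 (vertical_field c h) (x, y, y1) = c * y1 + h'"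
proof -
  have "(snd \<circ> vertical_field c h has_derivative (\<lambda>v. c * snd v + h' * fst v)) (at (x, y))"
    using has_derivative_snd[OF has_derivative_vertical_field[of h h' "(x, y)" c]] assms
    by (simp add: o_def)
  then have "frechet_derivative (snd \<circ> vertical_field c h) (at (x, y)) = (\<lambda>v. c * snd v + h' * fst v)"
    by (rule frechet_derivative_at[symmetric])
  moreover have "fst \<circ> vertical_field c h = (\<lambda>_. 0)"
    by (auto simp: vertical_field_def)
  ultimately show ?thesis
    by (simp add: zeta1_def total_deriv0_def frechet_derivative_const)
qed

text \<open>Differentiating \<open>zeta1\<close> needs its formula in a neighbourhood and not just
  at the point; the open set \<open>K \<times> UNIV\<close> provides one.\<close>

lemma has_derivative_zeta1_vertical_field:
  assumes "open K" "x \<in> K" "\<And>t. t \<in> K \<Longrightarrow> (h has_real_derivative h' t) (at t)"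
    and "(h' has_real_derivative h'') (at x)"
  shows "(zeta1 (vertical_field c h) has_derivative (\<lambda>v. c * snd (snd v) + h'' * fst v)) (at (x, y, y1))"
proof -
  have "((\<lambda>p::real \<times> real \<times> real. h' (fst p)) has_derivative (\<lambda>v. h'' * fst v)) (at (x, y, y1))"
    using has_derivative_compose[OF has_derivative_fst[OF has_derivative_ident], of h' _ "(x, y, y1)" UNIV]
      assms(4)[unfolded has_field_derivative_def] by simp
  then have "((\<lambda>p. c * snd (snd p) + h' (fst p)) has_derivative (\<lambda>v. c * snd (snd v) + h'' * fst v))
      (at (x, y, y1))"
    by (auto intro!: derivative_eq_intros)
  then show ?thesis
  proof (rule has_derivative_transform_within_open)
    show "open (K \<times> (UNIV :: (real \<times> real) set))"
      using \<open>open K\<close> by (intro open_Times open_UNIV)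
  qed (use assms(2) zeta1_vertical_field[OF assms(3)] in auto)
qed

lemma zeta2_vertical_field:
  assumes "open K" "x \<in> K" "\<And>t. t \<in> K \<Longrightarrow> (h has_real_derivative h' t) (at t)"
    and "(h' has_real_derivative h'') (at x)"
  shows "zeta2 (vertical_field c h) (x, y, y1, y2) = c * y2 + h''"
proof -
  have "frechet_derivative (zeta1 (vertical_field c h)) (at (x, y, y1))
      = (\<lambda>v. c * snd (snd v) + h'' * fst v)"
    by (rule frechet_derivative_at[OF has_derivative_zeta1_vertical_field[OF assms], symmetric])
  moreover have "fst \<circ> vertical_field c h = (\<lambda>_. 0)"
    by (auto simp: vertical_field_def)
  ultimately show ?thesis
    by (simp add: zeta2_def total_deriv0_def total_deriv1_def frechet_derivative_const)
qed

text \<open>Applied to y'' - f, the prolongation yields c times (y'' minus the homogeneous part of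
  f), which is c b on solutions, plus the same expression for \<open>h\<close>, which is -c b. The
  sum vanishes. Applied to x_- - g it gives 0 because \<xi> = 0 at both points.\<close>

lemma vertical_field_admits_symmetry:
  assumes "open K"
    and sm: "smooth_on K a1" "smooth_on K a2" "smooth_on K a3" "smooth_on K a4" "smooth_on K b" "smooth_on K g"
    and h: "dods_solution (linear_rhs a1 a2 a3 a4 (\<lambda>x. - c * b x)) g K h"
  shows "admits_symmetry (linear_rhs a1 a2 a3 a4 b) g K (vertical_field c h)"
  unfolding admits_symmetry_def
proof (intro conjI ballI allI impI)
  let ?V = "vertical_field c h"
  note h1 = dods_solutionD(1)[OF h] and h2 = dods_solutionD(2)[OF h]
  show "?V differentiable (at (x, y))" if "x \<in> K \<union> g ` K" for x y
    unfolding differentiable_def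
    using has_derivative_vertical_field[of h _ "(x, y)"] h1[OF that] by auto
  show "zeta1 ?V differentiable (at (x, y, y1))" if "x \<in> K" for x y y1
    using has_derivative_zeta1_vertical_field[OF \<open>open K\<close> that, of h] h1 h2[OF that]
    unfolding differentiable_def by blast
  fix x xm y ym y1 y1m y2
  assume x: "x \<in> K" and y2: "y2 = linear_rhs a1 a2 a3 a4 b x y ym y1 y1m" and xm: "xm = g x"
  let ?p = "(x, y, xm, ym, y1, y1m, y2)"
  \<comment> \<open>The x-derivatives of the coefficients must exist for
    \<open>pr_annihilates\<close>, but they are multiplied by \<xi> = 0 and drop out.\<close>
  have D: "((\<lambda>p::jet. k (fst p)) has_derivative (\<lambda>v. deriv k x * fst v)) (at ?p)"
    if "smooth_on K k" for k
    using has_derivative_compose[OF has_derivative_fst[OF has_derivative_ident], of k _ ?p UNIV]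
      smooth_on_DERIV[OF that \<open>open K\<close> x, unfolded has_field_derivative_def] by simp
  have pr: "prolong ?V ?p = (0, c * y + h x, 0, c * ym + h (g x), c * y1 + deriv h x,
      c * y1m + deriv h (g x),
      c * y2 + linear_rhs a1 a2 a3 a4 (\<lambda>x. - c * b x) x (h x) (h (g x)) (deriv h x) (deriv h (g x)))"
    using zeta2_vertical_field[OF \<open>open K\<close> x h1 h2[OF x], of c y y1 y2]
      zeta1_vertical_field[OF h1[of x], of c y y1] zeta1_vertical_field[OF h1[of "g x"], of c ym y1m] x
    by (simp add: prolong_def vertical_field_def xm)
  show "pr_annihilates ?V (\<lambda>(x, y, xm, ym, y1, y1m, y2). xm - g x) ?p"
    unfolding pr_annihilates_def case_prod_beta
    by (rule exI, rule conjI, (rule derivative_eq_intros D sm refl)+) (simp add: pr)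
  show "pr_annihilates ?V
      (\<lambda>(x, y, xm, ym, y1, y1m, y2). y2 - linear_rhs a1 a2 a3 a4 b x y ym y1 y1m) ?p"
    unfolding pr_annihilates_def case_prod_beta linear_rhs_def
    by (rule exI, rule conjI, (rule derivative_eq_intros D sm refl)+)
      (simp only: pr fst_conv snd_conv, simp add: y2 linear_rhs_def algebra_simps)
qed

section \<open>The Lie algebra structure\<close>

text \<open>Both fields have zero x-component, so only y-derivatives act: the bracket is d (c y + h)
  - c (d y + k), in which the terms in y cancel.\<close>

lemma lie_bracket_vertical_field:
  assumes "(h has_real_derivative h') (at (fst p))" "(k has_real_derivative k') (at (fst p))"
  shows "lie_bracket (vertical_field c h) (vertical_field d k) p
    = X_field (\<lambda>x. d * h x + (- c) * k x) p"
  unfolding lie_bracket_def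
    frechet_derivative_at[OF has_derivative_vertical_field[OF assms(1)], symmetric]
    frechet_derivative_at[OF has_derivative_vertical_field[OF assms(2)], symmetric]
  by (simp add: vertical_field_def X_field_def case_prod_beta algebra_simps)

lemma X_field_in_linear_symmetries:
  "dods_solution (linear_rhs a1 a2 a3 a4 (\<lambda>_. 0)) g K \<rho> \<Longrightarrow>
    X_field \<rho> \<in> linear_symmetries a1 a2 a3 a4 g \<sigma> K"
  unfolding linear_symmetries_def by (intro vf.span_base) blast

lemma lie_algebra_linear_symmetries:
  assumes "open K" and \<sigma>: "dods_solution (linear_rhs a1 a2 a3 a4 b) g K \<sigma>"
  shows "lie_algebra_on (base_domain g K) (linear_symmetries a1 a2 a3 a4 g \<sigma> K)"
  unfolding lie_algebra_on_def
proof (intro conjI ballI)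
  let ?L = "linear_symmetries a1 a2 a3 a4 g \<sigma> K"
  show "vf.subspace ?L"
    unfolding linear_symmetries_def by (rule vf.subspace_span)
  fix V assume "V \<in> ?L"
  then obtain c h where V: "V = vertical_field c h"
    and h: "dods_solution (linear_rhs a1 a2 a3 a4 (\<lambda>x. - c * b x)) g K h"
    using linear_symmetries_imp_vertical[OF assms] by metis
  have Dh: "(h has_real_derivative deriv h (fst p)) (at (fst p))" if "p \<in> base_domain g K" for p
    using dods_solutionD(1)[OF h] that by (auto simp: base_domain_def)
  show "V differentiable (at p)" if "p \<in> base_domain g K" for p
    unfolding V differentiable_def using has_derivative_vertical_field[OF Dh[OF that]] by blast
  fix W assume "W \<in> ?L"
  then obtain d k where W: "W = vertical_field d k"
    and k: "dods_solution (linear_rhs a1 a2 a3 a4 (\<lambda>x. - d * b x)) g K k"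
    using linear_symmetries_imp_vertical[OF assms] by metis
  have Dk: "(k has_real_derivative deriv k (fst p)) (at (fst p))" if "p \<in> base_domain g K" for p
    using dods_solutionD(1)[OF k] that by (auto simp: base_domain_def)
  show "\<exists>Z\<in>?L. \<forall>p\<in>base_domain g K. Z p = lie_bracket V W p"
  proof (intro bexI ballI)
    show "X_field (\<lambda>x. d * h x + (- c) * k x) p = lie_bracket V W p" if "p \<in> base_domain g K" for p
      unfolding V W using lie_bracket_vertical_field[OF Dh[OF that] Dk[OF that]] by simp
    \<comment> \<open>The inhomogeneities combine to d (-c b) - c (-d b) = 0.\<close>
    have "dods_solution (linear_rhs a1 a2 a3 a4 (\<lambda>_. 0)) g K (\<lambda>x. d * h x + (- c) * k x)"
      using dods_solution_linear_combination[OF \<open>open K\<close> h k, of d "- c"] by (simp add: mult_ac)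
    then show "X_field (\<lambda>x. d * h x + (- c) * k x) \<in> ?L"
      by (rule X_field_in_linear_symmetries)
  qed
qed

section \<open>A criterion for infinite dimension\<close>

lemma sum_vf_apply: "(\<Sum>n\<in>A. F n) p = (\<Sum>n\<in>A. F n p)" for F :: "'a \<Rightarrow> vector_field"
  by (induction A rule: infinite_finite_induct) auto

text \<open>A finite spanning set bounds the size of every independent set, while the given sequence
  has arbitrarily long independent initial segments. Independence is tested on \<open>D\<close>
  because fields are identified when they agree there.\<close>

lemma infinite_dimensional_onI:
  fixes V :: "nat \<Rightarrow> vector_field"
  assumes mem: "\<And>n. V n \<in> L"
    and indep: "\<And>N c. \<forall>p\<in>D. (\<Sum>n\<le>N. c n *\<^sub>R V n p) = 0 \<Longrightarrow> \<forall>n\<le>N. c n = 0"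
  shows "infinite_dimensional_on D L"
  unfolding infinite_dimensional_on_def
proof
  assume "\<exists>B. finite B \<and> restrict_vf D ` L \<subseteq> vf.span B"
  then obtain B where "finite B" and B: "restrict_vf D ` L \<subseteq> vf.span B" by blast
  define R where "R n = restrict_vf D (V n)" for n
  \<comment> \<open>The indices 0 to \<open>card B\<close> number one more than the elements of
    \<open>B\<close>, which is what contradicts the bound.\<close>
  let ?N = "card B"
  have sum0: "\<forall>n\<le>?N. c n = 0" if "(\<Sum>n\<le>?N. vf_scale (c n) (R n)) = 0" for c
  proof (rule indep, rule ballI)
    fix p assume "p \<in> D"
    have "(\<Sum>n\<le>?N. vf_scale (c n) (R n)) p = (\<Sum>n\<le>?N. c n *\<^sub>R V n p)"
      using \<open>p \<in> D\<close> by (simp add: sum_vf_apply vf_scale_def R_def restrict_vf_def)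
    then show "(\<Sum>n\<le>?N. c n *\<^sub>R V n p) = 0" using that by simp
  qed
  \<comment> \<open>The dimension bound counts distinct vectors, so repetitions must be excluded:
    two equal ones would give a relation with coefficients 1 and -1.\<close>
  have inj: "inj_on R {..?N}"
  proof (rule inj_onI, rule ccontr)
    fix m n assume mn: "m \<in> {..?N}" "n \<in> {..?N}" "R m = R n" "m \<noteq> n"
    let ?c = "\<lambda>i. if i = m then 1 else if i = n then - 1 else (0::real)"
    have "(\<Sum>i\<le>?N. vf_scale (?c i) (R i)) = (\<Sum>i\<in>{m, n}. vf_scale (?c i) (R i))"
      using mn by (intro sum.mono_neutral_right) (auto simp: vf_scale_def fun_eq_iff)
    also have "\<dots> = 0"
      using mn by (simp add: vf_scale_def fun_eq_iff)
    finally show False using sum0[of ?c] mn by auto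
  qed
  have "vf.independent (R ` {..?N})"
  proof (rule vf.independent_if_scalars_zero)
    fix f v assume "(\<Sum>v\<in>R ` {..?N}. vf_scale (f v) v) = 0" and v: "v \<in> R ` {..?N}"
    then have "(\<Sum>n\<le>?N. vf_scale (f (R n)) (R n)) = 0"
      by (simp add: sum.reindex[OF inj])
    then show "f v = 0" using sum0[of "f \<circ> R"] v by auto
  qed simp
  moreover have "R ` {..?N} \<subseteq> vf.span B" using B mem by (auto simp: R_def)
  ultimately have "card (R ` {..?N}) \<le> ?N"
    using vf.independent_span_bound[OF \<open>finite B\<close>] by blast
  then show False by (simp add: card_image[OF inj])
qed

section \<open>The method of steps and linearly independent solutions\<close>

text \<open>All delayed points lie to the left of \<open>a\<close>, where the solution is prescribed
  as \<open>\<phi>\<close>. The delayed terms thus become a known forcing term, and an ordinary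
  linear equation remains.\<close>

lemma homogeneous_dods_extension:
  assumes "a \<le> b" "(1 + 2 * A) * (b - a) < 1"
    and cont: "continuous_on {a..b} a1" "continuous_on {a..b} a2" "continuous_on {a..b} a3"
      "continuous_on {a..b} a4" "continuous_on {a..b} g"
    and bound: "\<And>t. t \<in> {a..b} \<Longrightarrow> \<bar>a1 t\<bar> \<le> A" "\<And>t. t \<in> {a..b} \<Longrightarrow> \<bar>a3 t\<bar> \<le> A"
    and delay: "\<And>t. t \<in> {a..b} \<Longrightarrow> g t < a"
    and \<phi>: "\<And>t. (\<phi> has_real_derivative \<phi>' t) (at t)" "continuous_on UNIV \<phi>'"
  obtains \<rho> where "dods_solution (linear_rhs a1 a2 a3 a4 (\<lambda>_. 0)) g {a<..<b} \<rho>"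
    and "\<And>t. t < a \<Longrightarrow> \<rho> t = \<phi> t"
proof -
  let ?f = "\<lambda>t. a2 t * \<phi>' (g t) + a4 t * \<phi> (g t)"
  have "continuous_on UNIV \<phi>"
    using \<phi>(1) by (intro continuous_at_imp_continuous_on) (blast intro: DERIV_isCont)
  then have f: "continuous_on {a..b} ?f"
    by (intro continuous_intros cont continuous_on_compose2[OF \<phi>(2) cont(5)]
        continuous_on_compose2[OF _ cont(5)]) auto
  obtain y y1 where
    y: "\<And>t. t \<in> {a<..<b} \<Longrightarrow> (y has_real_derivative y1 t) (at t)" and
    y1: "\<And>t. t \<in> {a<..<b} \<Longrightarrow> (y1 has_real_derivative a1 t * y1 t + a3 t * y t + ?f t) (at t)"
    using linear_second_order_ode_short_interval[OF assms(1,2) cont(1,3) f bound] by blast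
  \<comment> \<open>The two pieces may fail to match at \<open>a\<close>. This is harmless, since
    \<open>a\<close> lies neither in \<open>{a<..<b}\<close> nor among the delayed points.\<close>
  define \<rho> where "\<rho> t = (if t < a then \<phi> t else y t)" for t
  define \<rho>' where "\<rho>' t = (if t < a then \<phi>' t else y1 t)" for t
  show ?thesis
  proof
    show "dods_solution (linear_rhs a1 a2 a3 a4 (\<lambda>_. 0)) g {a<..<b} \<rho>"
    proof (rule dods_solutionI)
      fix x assume "x \<in> {a<..<b} \<union> g ` {a<..<b}"
      then consider "x \<in> {a<..<b}" | "x < a" using delay by fastforce
      then show "(\<rho> has_real_derivative \<rho>' x) (at x)"
      proof cases
        case 1
        show ?thesis
          by (rule has_field_derivative_transform_within_open[where f = y and S = "{a<..<b}"])
            (use 1 y[OF 1] in \<open>auto simp: \<rho>_def \<rho>'_def\<close>)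
      next
        case 2
        show ?thesis
          by (rule has_field_derivative_transform_within_open[where f = \<phi> and S = "{..<a}"])
            (use 2 \<phi>(1)[of x] in \<open>auto simp: \<rho>_def \<rho>'_def\<close>)
      qed
    next
      fix x assume x: "x \<in> {a<..<b}"
      then have "g x < a" using delay by auto
      show "(\<rho>' has_real_derivative
          linear_rhs a1 a2 a3 a4 (\<lambda>_. 0) x (\<rho> x) (\<rho> (g x)) (\<rho>' x) (\<rho>' (g x))) (at x)"
        by (rule has_field_derivative_transform_within_open[where f = y1 and S = "{a<..<b}"])
          (use x y1[OF x] \<open>g x < a\<close> in \<open>auto simp: \<rho>_def \<rho>'_def linear_rhs_def algebra_simps\<close>)
    qed simp
  qed (simp add: \<rho>_def)
qed

lemma infinite_dimensional_linear_symmetries_local: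
  assumes "open J" "x0 \<in> J" "g x0 < x0"
    and cont: "continuous_on J a1" "continuous_on J a2" "continuous_on J a3"
      "continuous_on J a4" "continuous_on J g"
  obtains \<epsilon> where "\<epsilon> > 0" and
    "\<And>K. \<lbrakk>connected K; K \<subseteq> ball x0 \<epsilon>; \<not> g constant_on K\<rbrakk> \<Longrightarrow>
      infinite_dimensional_on (base_domain g K) (linear_symmetries a1 a2 a3 a4 g \<sigma> K)"
proof -
  obtain r where "r > 0" and r: "cball x0 r \<subseteq> J"
    using \<open>open J\<close> \<open>x0 \<in> J\<close> open_contains_cball by blast
  have "bounded (a1 ` cball x0 r \<union> a3 ` cball x0 r)"
    unfolding bounded_Un
    by (intro conjI compact_imp_bounded compact_continuous_image compact_cball
        continuous_on_subset[OF cont(1) r] continuous_on_subset[OF cont(3) r])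
  then obtain A where "A > 0" and A: "\<And>v. v \<in> a1 ` cball x0 r \<union> a3 ` cball x0 r \<Longrightarrow> \<bar>v\<bar> \<le> A"
    unfolding bounded_pos by auto
  have "isCont g x0"
    using cont(5) assms(1,2) by (simp add: continuous_on_eq_continuous_at)
  then have "\<forall>\<^sub>F t in nhds x0. g t < (g x0 + x0) / 2"
    unfolding isCont_def tendsto_at_iff_tendsto_nhds
    by (rule order_tendstoD) (use \<open>g x0 < x0\<close> in simp)
  then obtain d where "d > 0" and d: "\<And>t. dist t x0 < d \<Longrightarrow> g t < (g x0 + x0) / 2"
    unfolding eventually_nhds_metric by blast
  \<comment> \<open>The four bounds keep the interval where \<open>A\<close> bounds the
    coefficients, keep g(t) below the midpoint of \<open>g x0\<close> and \<open>x0\<close>, keep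
    \<open>a\<close> at or above that midpoint, and give (1 + 2A)(b - a) \<le> 1/2.\<close>
  define \<epsilon> where "\<epsilon> = Min {r, d / 2, (x0 - g x0) / 2, 1 / (4 * (1 + 2 * A))}"
  have \<epsilon>: "\<epsilon> > 0" "\<epsilon> \<le> r" "\<epsilon> < d" "\<epsilon> \<le> (x0 - g x0) / 2" "\<epsilon> \<le> 1 / (4 * (1 + 2 * A))"
    using \<open>r > 0\<close> \<open>d > 0\<close> \<open>A > 0\<close> \<open>g x0 < x0\<close> by (auto simp: \<epsilon>_def min_def)
  define a b where "a = x0 - \<epsilon>" and "b = x0 + \<epsilon>"
  have ab: "a \<le> b" "{a..b} \<subseteq> cball x0 r" "{a..b} \<subseteq> J"
    using \<epsilon> r by (auto simp: a_def b_def cball_eq_atLeastAtMost)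
  have short: "(1 + 2 * A) * (b - a) < 1"
    using \<epsilon>(5) \<open>A > 0\<close> by (simp add: a_def b_def field_simps)
  have delay: "g t < a" if "t \<in> {a..b}" for t
  proof -
    have "\<bar>t - x0\<bar> \<le> \<epsilon>" using that by (auto simp: a_def b_def)
    then have "g t < (g x0 + x0) / 2" using d[of t] \<epsilon>(3) by (simp add: dist_real_def)
    also have "\<dots> \<le> a" using \<epsilon>(4) by (simp add: a_def field_simps)
    finally show ?thesis .
  qed
  have \<rho>_ex: "\<exists>\<rho>. dods_solution (linear_rhs a1 a2 a3 a4 (\<lambda>_. 0)) g {a<..<b} \<rho> \<and> (\<forall>t<a. \<rho> t = t ^ n)"
    for n :: nat
  proof -
    note sub = continuous_on_subset[OF _ ab(3)]
    have deriv: "((\<lambda>t. t ^ n) has_real_derivative real n * t ^ (n - 1)) (at t)" for t :: real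
      by (auto intro!: derivative_eq_intros)
    have cont': "continuous_on UNIV (\<lambda>t::real. real n * t ^ (n - 1))"
      by (intro continuous_intros)
    have "\<bar>a1 t\<bar> \<le> A" "\<bar>a3 t\<bar> \<le> A" if "t \<in> {a..b}" for t
      using A ab(2) that by blast+
    then show ?thesis
      by (rule_tac homogeneous_dods_extension[OF ab(1) short sub[OF cont(1)] sub[OF cont(2)]
          sub[OF cont(3)] sub[OF cont(4)] sub[OF cont(5)] _ _ delay deriv cont']) blast+
  qed
  then obtain \<rho> where
    \<rho>: "\<And>n. dods_solution (linear_rhs a1 a2 a3 a4 (\<lambda>_. 0)) g {a<..<b} (\<rho> n)"
    and \<rho>_left: "\<And>n t. t < a \<Longrightarrow> \<rho> n t = t ^ n"
    by metis
  show ?thesis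
  proof
    fix K assume "connected K" and "K \<subseteq> ball x0 \<epsilon>" and nonconst: "\<not> g constant_on K"
    then have K: "K \<subseteq> {a<..<b}" by (simp add: a_def b_def ball_eq_greaterThanLessThan)
    also have "\<dots> \<subseteq> J" using ab(3) by auto
    finally have "connected (g ` K)"
      using \<open>connected K\<close> cont(5) connected_continuous_image continuous_on_subset by blast
    moreover have "\<nexists>c. g ` K \<subseteq> {c}"
      using nonconst unfolding constant_on_def by blast
    \<comment> \<open>A finite connected set is empty or a singleton.\<close>
    ultimately have inf: "infinite (g ` K)"
      by (metis connected_finite_iff_sing empty_subsetI subset_refl)
    show "infinite_dimensional_on (base_domain g K) (linear_symmetries a1 a2 a3 a4 g \<sigma> K)"
    proof (rule infinite_dimensional_onI)
      show "X_field (\<rho> n) \<in> linear_symmetries a1 a2 a3 a4 g \<sigma> K" for n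
        by (intro X_field_in_linear_symmetries dods_solution_mono[OF \<rho> K])
      fix N and c :: "nat \<Rightarrow> real"
      assume zero: "\<forall>p\<in>base_domain g K. (\<Sum>n\<le>N. c n *\<^sub>R X_field (\<rho> n) p) = 0"
      have "g ` K \<subseteq> {s. (\<Sum>n\<le>N. c n * s ^ n) = 0}"
      proof safe
        fix x assume "x \<in> K"
        then have "g x < a" using delay K by auto
        \<comment> \<open>The relation is evaluated over the delayed point \<open>g x\<close>, which
          belongs to the base domain and where the solutions are the explicit powers.\<close>
        have "(\<Sum>n\<le>N. c n * \<rho> n (g x)) = snd (\<Sum>n\<le>N. c n *\<^sub>R X_field (\<rho> n) (g x, 0))"
          by (simp add: snd_sum X_field_def)
        also have "\<dots> = 0"
          using zero \<open>x \<in> K\<close> by (simp add: base_domain_def)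
        finally show "(\<Sum>n\<le>N. c n * g x ^ n) = 0"
          using \<open>g x < a\<close> by (simp add: \<rho>_left)
      qed
      then have "infinite {s. (\<Sum>n\<le>N. c n * s ^ n) = 0}"
        using inf infinite_super by blast
      then show "\<forall>n\<le>N. c n = 0"
        unfolding polyfun_finite_roots by blast
    qed
  qed (rule \<epsilon>(1))
qed

section \<open>Localisation and assembly\<close>

text \<open>The admissible radius depends on the centre, so nonconstancy on \<open>J\<close> has to
  be found arbitrarily close to a single point. Otherwise \<open>g\<close> would be locally
  constant, hence constant on the connected set \<open>J\<close>.\<close>

lemma nonconstant_point:
  fixes g :: "real \<Rightarrow> real"
  assumes "connected J" "\<not> g constant_on J"
  obtains x0 where "x0 \<in> J" "\<And>e. e > 0 \<Longrightarrow> \<not> g constant_on (J \<inter> ball x0 e)"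
proof -
  have "\<exists>x0\<in>J. \<forall>e>0. \<not> g constant_on (J \<inter> ball x0 e)"
  proof (rule ccontr)
    assume neg: "\<not> ?thesis"
    have "g constant_on J"
    proof (rule locally_constant_imp_constant[OF \<open>connected J\<close>])
      fix x assume "x \<in> J"
      then obtain e where "e > 0" "g constant_on (J \<inter> ball x e)" using neg by blast
      then show "\<exists>T. openin (top_of_set J) T \<and> x \<in> T \<and> (\<forall>t\<in>T. g t = g x)"
        using \<open>x \<in> J\<close> by (intro exI[of _ "J \<inter> ball x e"])
          (auto simp: constant_on_def openin_open)
    qed
    with assms(2) show False ..
  qed
  then show ?thesis using that by blast
qed

theorem theorem4p3:
  fixes I J :: "real set" and a1 a2 a3 a4 b g \<sigma> :: "real \<Rightarrow> real"
  assumes "open_interval I"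
    and "smooth_on I a1" "smooth_on I a2" "smooth_on I a3" "smooth_on I a4"
    and "smooth_on I b" "smooth_on I g"
    and "\<exists>x\<in>I. (a2 x)\<^sup>2 + (a4 x)\<^sup>2 \<noteq> 0"
    and "\<forall>x\<in>I. g x < x"
    and "\<not> g constant_on I"
    and "open_interval J" "J \<subseteq> I"
    and "dods_solution (linear_rhs a1 a2 a3 a4 b) g J \<sigma>"
  shows "(\<forall>K. open_interval K \<and> K \<subseteq> J \<longrightarrow>
           lie_algebra_on (base_domain g K) (linear_symmetries a1 a2 a3 a4 g \<sigma> K) \<and>
           (\<forall>V \<in> linear_symmetries a1 a2 a3 a4 g \<sigma> K.
              admits_symmetry (linear_rhs a1 a2 a3 a4 b) g K V))
         \<and> (\<forall>x0\<in>J. \<exists>\<epsilon>>0. \<forall>K. open_interval K \<and> K \<subseteq> J \<and> x0 \<in> K \<and> K \<subseteq> ball x0 \<epsilon> \<and> \<not> g constant_on K \<longrightarrow>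
           infinite_dimensional_on (base_domain g K) (linear_symmetries a1 a2 a3 a4 g \<sigma> K))
         \<and> (\<not> g constant_on J \<longrightarrow>
           (\<exists>K. open_interval K \<and> K \<subseteq> J \<and>
              infinite_dimensional_on (base_domain g K) (linear_symmetries a1 a2 a3 a4 g \<sigma> K)))"
    (is "?algebra \<and> ?local \<and> ?global")
proof (intro conjI)
  let ?inf = "\<lambda>K. infinite_dimensional_on (base_domain g K) (linear_symmetries a1 a2 a3 a4 g \<sigma> K)"
  have J: "open J" "is_interval J" using \<open>open_interval J\<close> by (auto simp: open_interval_def)
  show ?algebra
  proof (intro allI impI)
    fix K assume K: "open_interval K \<and> K \<subseteq> J"
    then have "open K" by (simp add: open_interval_def)
    have sm: "smooth_on K h" if "smooth_on I h" for h
      using smooth_on_subset[OF that] K \<open>J \<subseteq> I\<close> by blast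
    have \<sigma>: "dods_solution (linear_rhs a1 a2 a3 a4 b) g K \<sigma>"
      using assms(13) K dods_solution_mono by blast
    have "admits_symmetry (linear_rhs a1 a2 a3 a4 b) g K V"
      if "V \<in> linear_symmetries a1 a2 a3 a4 g \<sigma> K" for V
      using linear_symmetries_imp_vertical[OF \<open>open K\<close> \<sigma> that]
        vertical_field_admits_symmetry[OF \<open>open K\<close> sm[OF assms(2)] sm[OF assms(3)] sm[OF assms(4)]
          sm[OF assms(5)] sm[OF assms(6)] sm[OF assms(7)]] by metis
    then show "lie_algebra_on (base_domain g K) (linear_symmetries a1 a2 a3 a4 g \<sigma> K) \<and>
        (\<forall>V \<in> linear_symmetries a1 a2 a3 a4 g \<sigma> K. admits_symmetry (linear_rhs a1 a2 a3 a4 b) g K V)"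
      using lie_algebra_linear_symmetries[OF \<open>open K\<close> \<sigma>] by blast
  qed
  \<comment> \<open>This form, for arbitrary connected sets in the ball, yields the local claim and
    also the last one, with \<open>J \<inter> ball x0 \<epsilon>\<close> as the interval.\<close>
  have local: "\<exists>\<epsilon>>0. \<forall>K. connected K \<and> K \<subseteq> ball x0 \<epsilon> \<and> \<not> g constant_on K \<longrightarrow> ?inf K"
    if x0: "x0 \<in> J" for x0
  proof -
    have cont: "continuous_on J h" if "smooth_on I h" for h
      using smooth_on_imp_continuous_on[OF that] \<open>J \<subseteq> I\<close> continuous_on_subset by blast
    have "g x0 < x0" using x0 assms(9) \<open>J \<subseteq> I\<close> by blast
    from infinite_dimensional_linear_symmetries_local[OF J(1) x0 this cont[OF assms(2)]
        cont[OF assms(3)] cont[OF assms(4)] cont[OF assms(5)] cont[OF assms(7)]]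
    show ?thesis by metis
  qed
  then show ?local
    unfolding open_interval_def by (meson is_interval_connected)
  show ?global
  proof
    assume "\<not> g constant_on J"
    then obtain x0 where "x0 \<in> J" and x0: "\<And>e. e > 0 \<Longrightarrow> \<not> g constant_on (J \<inter> ball x0 e)"
      using nonconstant_point is_interval_connected[OF J(2)] by blast
    obtain \<epsilon> where "\<epsilon> > 0" and
      \<epsilon>: "\<And>K. connected K \<Longrightarrow> K \<subseteq> ball x0 \<epsilon> \<Longrightarrow> \<not> g constant_on K \<Longrightarrow> ?inf K"
      using local[OF \<open>x0 \<in> J\<close>] by blast
    let ?K = "J \<inter> ball x0 \<epsilon>"
    have "open_interval ?K"
      using J \<open>x0 \<in> J\<close> \<open>\<epsilon> > 0\<close> unfolding open_interval_def
      by (auto simp: is_interval_ball_real intro!: is_interval_Int)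
    then show "\<exists>K. open_interval K \<and> K \<subseteq> J \<and> ?inf K"
      using \<epsilon>[of ?K] x0[OF \<open>\<epsilon> > 0\<close>] by (auto simp: open_interval_def is_interval_connected)
  qed
qed

end
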